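(* Let $\widehat{\Lambda} = \Lambda \cup \{(\hat{x},\hat{y})\}$, where $\Lambda=\{(x_i,y_i): i=0,1,\ldots,N\}$ and $x_{k-1} < \hat{x} < x_k$ for some $k\in\{1,\ldots,N\}$, and let $\hat z\in\mathbb{R}$ be arbitrary. Then the iterated function system $$\{I \times \mathbb{R}^2;\ \omega_n \ (n=1,2,\ldots, N,\ n\neq k),\ \omega_k^l,\ \omega_k^r \}$$ with $\omega_n=(L_n,F_n)$, $\omega_k^l =(L_k^l,F_k^l)$ and $\omega_k^r =(L_k^r,F_k^r)$ is a hyperbolic IFS on $I \times \mathbb{R}^2$, and there exists an attractor $\hat{A}$ satisfying $$\hat{A} = \bigcup_{\substack{n=1 \\ n\neq k}}^N \omega_n(\hat{A})\ \cup\ \omega_k^l(\hat{A})\ \cup\ \omega_k^r(\hat{A}).$$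
   Context: Data: real numbers $x_0<x_1<\dots<x_N$ with $N\ge 2$, real $y_i$, and real parameters $z_i$, $i=0,\ldots,N$; $I=[x_0,x_N]$, $I_n=[x_{n-1},x_n]$. For $n=1,\ldots,N$: $L_n:I\to I_n$, $L_n(x)=x_{n-1}+\frac{x_n-x_{n-1}}{x_N-x_0}(x-x_0)$, and $F_n:I\times\mathbb{R}^2\to\mathbb{R}^2$, $F_n(x,y,z)=(\alpha_n y+\beta_n z+p_n(x),\ \gamma_n z+q_n(x))$, where $|\alpha_n|<1$, $|\gamma_n|<1$, $|\beta_n|+|\gamma_n|<1$, and $p_n,q_n:I\to\mathbb{R}$ are continuous functions such that the join-up conditions $F_n(x_0,y_0,z_0)=(y_{n-1},z_{n-1})$ and $F_n(x_N,y_N,z_N)=(y_n,z_n)$ hold. For the inserted point $(\hat x,\hat y,\hat z)$ with $x_{k-1}<\hat x<x_k$: $L_k^l:I\to[x_{k-1},\hat x]$, $L_k^l(x)=x_{k-1}+\frac{\hat x-x_{k-1}}{x_N-x_0}(x-x_0)$; $L_k^r:I\to[\hat x,x_k]$, $L_k^r(x)=\hat x+\frac{x_k-\hat x}{x_N-x_0}(x-x_0)$; and for $s\in\{l,r\}$, $F_k^s:I\times\mathbb{R}^2\to\mathbb{R}^2$, $F_k^s(x,y,z)=(\alpha_k^s y+\beta_k^s z+p_k^s(x),\ \gamma_k^s z+q_k^s(x))$, where $|\alpha_k^s|<1$, $|\gamma_k^s|<1$, $|\beta_k^s|+|\gamma_k^s|<1$, and $p_k^s,q_k^s:I\to\mathbb{R}$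 are continuous functions such that $F_k^l(x_0,y_0,z_0)=(y_{k-1},z_{k-1})$, $F_k^l(x_N,y_N,z_N)=(\hat y,\hat z)$, $F_k^r(x_0,y_0,z_0)=(\hat y,\hat z)$, $F_k^r(x_N,y_N,z_N)=(y_k,z_k)$. Here $(L,F)$ denotes the map $(x,y,z)\mapsto (L(x),F(x,y,z))$ from $I\times\mathbb{R}^2$ to itself. An IFS on $I\times\mathbb{R}^2$ (a finite family of self-maps) is hyperbolic if there is a complete metric on $I\times\mathbb{R}^2$, equivalent to the Euclidean metric (inducing the same topology), with respect to which every map of the family is a contraction (Lipschitz constant $<1$). Its attractor is the unique non-empty compact set equal to the union of its images under the maps of the family. *)

theory Defs
  imports "HOL-Analysis.Analysis"
begin

text \<open>
  The metric \<open>d\<close> is an arbitrary complete metric on \<open>X\<close>, not the one of the type \<open>'a\<close>; "equivalent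
  to the given metric" means that both induce the same topology on \<open>X\<close>.
  Maps are total functions of which only the restriction to \<open>X\<close> matters.
\<close>

definition hyperbolic_ifs :: "'a::metric_space set \<Rightarrow> ('a \<Rightarrow> 'a) set \<Rightarrow> bool" where
  "hyperbolic_ifs X W \<longleftrightarrow>
     finite W \<and> (\<forall>f\<in>W. f ` X \<subseteq> X) \<and>
     (\<exists>d. Metric_space X d \<and> Metric_space.mcomplete X d \<and>
          Metric_space.mtopology X d = top_of_set X \<and>
          (\<forall>f\<in>W. \<exists>c. 0 \<le> c \<and> c < 1 \<and> (\<forall>u\<in>X. \<forall>v\<in>X. d (f u) (f v) \<le> c * d u v)))"

definition invariant_compact :: "'a::metric_space set \<Rightarrow> ('a \<Rightarrow> 'a) set \<Rightarrow> 'a set \<Rightarrow> bool" where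
  "invariant_compact X W A \<longleftrightarrow> A \<subseteq> X \<and> A \<noteq> {} \<and> compact A \<and> A = (\<Union>f\<in>W. f ` A)"

definition is_attractor :: "'a::metric_space set \<Rightarrow> ('a \<Rightarrow> 'a) set \<Rightarrow> 'a set \<Rightarrow> bool" where
  "is_attractor X W A \<longleftrightarrow>
     invariant_compact X W A \<and> (\<forall>B. invariant_compact X W B \<longrightarrow> B = A)"

text \<open>The increasing affine map from \<open>[a, b]\<close> onto \<open>[c, d]\<close>.\<close>

definition Lmap :: "real \<Rightarrow> real \<Rightarrow> real \<Rightarrow> real \<Rightarrow> real \<Rightarrow> real" where
  "Lmap a b c d t = c + (d - c) / (b - a) * (t - a)"

definition Fmap ::
  "real \<Rightarrow> real \<Rightarrow> real \<Rightarrow> (real \<Rightarrow> real) \<Rightarrow> (real \<Rightarrow> real) \<Rightarrow> real \<times> real \<times> real \<Rightarrow> real \<times> real" where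
  "Fmap \<alpha> \<beta> \<gamma> p q = (\<lambda>(x, y, z). (\<alpha> * y + \<beta> * z + p x, \<gamma> * z + q x))"

definition pair_map ::
  "(real \<Rightarrow> real) \<Rightarrow> (real \<times> real \<times> real \<Rightarrow> real \<times> real) \<Rightarrow> real \<times> real \<times> real \<Rightarrow> real \<times> real \<times> real" where
  "pair_map L F = (\<lambda>(x, y, z). (L x, F (x, y, z)))"

end

theory Submission
  imports Defs
begin

text \<open>
  Since \<open>p\<^sub>n\<close> and \<open>q\<^sub>n\<close> are only continuous, the maps need not be Lipschitz for the Euclidean metric.
  The join-up conditions, however, yield a continuous \<open>f = (g, h)\<close> whose graph is mapped into itself: first
  \<open>h\<close> and then \<open>g\<close> is the fixed point of a Read-Bajraktarevic operator, a contraction for the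
  supremum metric. After the shear \<open>(s, w) \<mapsto> (s, w - f s)\<close> every map of the system acts as an affine
  contraction in \<open>s\<close> and as the linear map with rows \<open>(\<alpha>, \<beta>)\<close>, \<open>(0, \<gamma>)\<close> in \<open>w\<close>, whose
  operator norm for the \<open>\<ell>\<^sup>1\<close> norm is \<open>max \<bar>\<alpha>\<bar> (\<bar>\<beta>\<bar> + \<bar>\<gamma>\<bar>) < 1\<close>. So the \<open>\<ell>\<^sup>1\<close> metric pulled
  back along the shear is the desired one, and the attractor is the graph of \<open>f\<close>. The system with the
  inserted point is of the same kind, over a partition with one more node.
\<close>

section \<open>Partitions of an interval and affine maps between intervals\<close>

lemma nodes_cover:
  fixes t :: "nat \<Rightarrow> real"
  assumes "t 0 \<le> s" "s \<le> t M" "M \<ge> 1"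
  shows "\<exists>n\<in>{1..M}. t (n - 1) \<le> s \<and> s \<le> t n"
  using assms(2,3)
proof (induction M)
  case (Suc M)
  show ?case
  proof (cases "M \<ge> 1 \<and> s \<le> t M")
    case True
    then show ?thesis using Suc.IH by (meson atLeastAtMost_iff le_SucI)
  next
    case False
    then have "t M \<le> s" using assms(1) by (cases "M = 0") auto
    then show ?thesis using Suc.prems by (intro bexI[of _ "Suc M"]) auto
  qed
qed simp

lemma nodes_mono:
  fixes t :: "nat \<Rightarrow> real"
  assumes "strict_mono_on {0..M} t" "n \<in> {1..M}"
  shows "t 0 \<le> t (n - 1)" "t (n - 1) < t n" "t n \<le> t M"
proof -
  have "n - 1 \<le> M" "n - 1 < n" "n \<le> M" using assms(2) by auto
  then show "t 0 \<le> t (n - 1)" "t (n - 1) < t n" "t n \<le> t M"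
    using strict_mono_on_leD[OF assms(1), of 0 "n - 1"] strict_mono_onD[OF assms(1), of "n - 1" n]
      strict_mono_on_leD[OF assms(1), of n M] by auto
qed

lemma Lmap_endpoints [simp]:
  assumes "a \<noteq> b"
  shows "Lmap a b c d a = c" "Lmap a b c d b = d"
  using assms by (auto simp: Lmap_def)

lemma Lmap_inverse:
  assumes "a \<noteq> b" "c \<noteq> d"
  shows "Lmap a b c d (Lmap c d a b s) = s"
  using assms by (simp add: Lmap_def)

lemma Lmap_in:
  assumes "a < b" "c \<le> d" "s \<in> {a..b}"
  shows "Lmap a b c d s \<in> {c..d}"
proof -
  have "0 \<le> (s - a) / (b - a)" "(s - a) / (b - a) \<le> 1"
    using assms by auto
  then have "0 \<le> (d - c) * ((s - a) / (b - a))" "(d - c) * ((s - a) / (b - a)) \<le> (d - c) * 1"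
    using assms(2) by (intro mult_nonneg_nonneg mult_left_mono; simp)+
  then show ?thesis by (simp add: Lmap_def)
qed

lemma continuous_on_Lmap [continuous_intros]: "continuous_on S (Lmap a b c d)"
  unfolding Lmap_def by (intro continuous_intros)

lemma Lmap_diff: "Lmap a b c d s - Lmap a b c d s' = (d - c) / (b - a) * (s - s')"
  by (simp add: Lmap_def algebra_simps diff_divide_distrib)

section \<open>Continuous fractal interpolation functions\<close>

text \<open>This is the pasting lemma for a finite closed cover. By strict monotonicity two of the
  subintervals meet at most in the common node of two neighbours, so agreement at the inner nodes is
  all that has to be assumed.\<close>

lemma continuous_glue_nodes:
  fixes t :: "nat \<Rightarrow> real" and \<phi> :: "nat \<Rightarrow> real \<Rightarrow> real"
  assumes t: "strict_mono_on {0..M} t" and "M \<ge> 1"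
    and cont: "\<And>n. n \<in> {1..M} \<Longrightarrow> continuous_on {t (n - 1)..t n} (\<phi> n)"
    and join: "\<And>n. n \<in> {1..<M} \<Longrightarrow> \<phi> n (t n) = \<phi> (Suc n) (t n)"
  obtains h where "continuous_on {t 0..t M} h"
    "\<And>n s. n \<in> {1..M} \<Longrightarrow> s \<in> {t (n - 1)..t n} \<Longrightarrow> h s = \<phi> n s"
proof -
  have mono: "t i \<le> t j" if "i \<le> j" "j \<le> M" for i j
    using strict_mono_on_leD[OF t] that by auto
  have agree: "\<phi> i s = \<phi> j s"
    if "i \<in> {1..M}" "j \<in> {1..M}" "i < j" "s \<in> {t (i - 1)..t i}" "s \<in> {t (j - 1)..t j}" for i j s
  proof -
    have "t i \<le> t (j - 1)" using that mono[of i "j - 1"] by auto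
    then have "t i = t (j - 1)" "s = t i" using that by auto
    then have "j = Suc i" using strict_mono_on_eqD[OF t, of i "j - 1"] that by auto
    then show ?thesis using join[of i] \<open>s = t i\<close> that by auto
  qed
  have pieces: "continuous_map (subtopology (top_of_set {t 0..t M}) {t (n - 1)..t n}) euclideanreal (\<phi> n)"
    if "n \<in> {1..M}" for n
    using cont[OF that] by (auto simp: subtopology_subtopology continuous_map_iff_continuous
        intro: continuous_on_subset)
  have agree': "\<phi> i s = \<phi> j s"
    if "i \<in> {1..M}" "j \<in> {1..M}"
      "s \<in> topspace (top_of_set {t 0..t M}) \<inter> {t (i - 1)..t i} \<inter> {t (j - 1)..t j}" for i j s
    using agree[of i j s] agree[of j i s] that by (cases i j rule: linorder_cases) auto
  have closed: "closedin (top_of_set {t 0..t M}) {t (n - 1)..t n}" if "n \<in> {1..M}" for n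
    using nodes_mono[OF t that] by (intro closed_subset) auto
  have cover: "topspace (top_of_set {t 0..t M}) \<subseteq> (\<Union>n\<in>{1..M}. {t (n - 1)..t n})"
    using nodes_cover[of t _ M] \<open>M \<ge> 1\<close> by fastforce
  obtain h where h: "continuous_map (top_of_set {t 0..t M}) euclideanreal h"
    "\<And>s n. n \<in> {1..M} \<Longrightarrow> s \<in> topspace (top_of_set {t 0..t M}) \<inter> {t (n - 1)..t n} \<Longrightarrow> h s = \<phi> n s"
    by (rule pasting_lemma_exists_closed[of "{1..M}" "top_of_set {t 0..t M}" "\<lambda>n. {t (n - 1)..t n}" euclideanreal \<phi>,
          OF finite_atLeastAtMost cover closed pieces agree']) blast+
  show ?thesis
  proof
    show "continuous_on {t 0..t M} h" using h(1) by simp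
    show "h s = \<phi> n s" if "n \<in> {1..M}" "s \<in> {t (n - 1)..t n}" for n s
      using h(2)[of n s] nodes_mono[OF t that(1)] that by auto
  qed
qed

text \<open>\<open>f\<close> is the Banach fixed point of the operator \<open>T\<close> with
  \<open>T g (L n s) = \<alpha> n * g s + r n s\<close>, acting on the continuous functions with the
  prescribed end values. The join conditions make the pieces of \<open>T g\<close> agree at the
  nodes and preserve the end values; the contraction factor is the largest
  \<open>\<bar>\<alpha> n\<bar>\<close>.\<close>

lemma fractal_interpolant:
  fixes t y \<alpha> :: "nat \<Rightarrow> real" and r :: "nat \<Rightarrow> real \<Rightarrow> real"
  assumes t: "strict_mono_on {0..M} t" and M: "M \<ge> 1"
    and \<alpha>: "\<And>n. n \<in> {1..M} \<Longrightarrow> \<bar>\<alpha> n\<bar> < 1"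
    and r: "\<And>n. n \<in> {1..M} \<Longrightarrow> continuous_on {t 0..t M} (r n)"
    and join0: "\<And>n. n \<in> {1..M} \<Longrightarrow> \<alpha> n * y 0 + r n (t 0) = y (n - 1)"
    and join1: "\<And>n. n \<in> {1..M} \<Longrightarrow> \<alpha> n * y M + r n (t M) = y n"
  obtains f where "continuous_on {t 0..t M} f" "f (t 0) = y 0" "f (t M) = y M"
    "\<And>n s. n \<in> {1..M} \<Longrightarrow> s \<in> {t 0..t M} \<Longrightarrow>
       f (Lmap (t 0) (t M) (t (n - 1)) (t n) s) = \<alpha> n * f s + r n s"
proof -
  define a b where "a = t 0" and "b = t M"
  define L where "L n = Lmap a b (t (n - 1)) (t n)" for n
  have ab: "a < b"
    using strict_mono_onD[OF t, of 0 M] M by (auto simp: a_def b_def)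
  have less: "t (n - 1) < t n" if "n \<in> {1..M}" for n
    using nodes_mono(2)[OF t that] .
  \<comment> \<open>Writing the two end conditions as a product of closed sets gives closedness of
    \<open>S\<close> directly.\<close>
  define S where "S = PiC UNIV (\<lambda>s. if s = a then {y 0} else if s = b then {y M} else (UNIV :: real set))"
  have S_iff: "g \<in> S \<longleftrightarrow> g a = y 0 \<and> g b = y M" for g :: "real \<Rightarrow>\<^sub>C real"
    using ab by (auto simp: S_def mem_PiC_iff Pi_iff)
  \<comment> \<open>The functions live on the whole line, but only their values on
    \<open>[a, b]\<close> matter. The clause with \<open>clamp\<close> makes the image constant on
    either side of \<open>[a, b]\<close>, so that the supremum distance of two images is determined
    on \<open>[a, b]\<close>.\<close>
  have "\<exists>h :: real \<Rightarrow>\<^sub>C real. (\<forall>n\<in>{1..M}. \<forall>s\<in>{a..b}. h (L n s) = \<alpha> n * g s + r n s) \<and>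
      (\<forall>s. h s = h (clamp a b s))" if g: "g \<in> S" for g
  proof -
    \<comment> \<open>\<open>Lmap\<close> with its two intervals exchanged is the inverse of
      \<open>L n\<close>, so \<open>\<phi> n\<close> is the prescribed image of \<open>g\<close> on
      the \<open>n\<close>-th subinterval.\<close>
    define \<phi> where "\<phi> n s = (\<lambda>s. \<alpha> n * g s + r n s) (Lmap (t (n - 1)) (t n) a b s)" for n s
    have "continuous_on {t (n - 1)..t n} (\<phi> n)" if n: "n \<in> {1..M}" for n
    proof -
      have "continuous_on {a..b} (\<lambda>s. \<alpha> n * g s + r n s)"
        using r[OF n] by (intro continuous_intros) (auto simp: a_def b_def)
      moreover have "Lmap (t (n - 1)) (t n) a b ` {t (n - 1)..t n} \<subseteq> {a..b}"
        using Lmap_in[OF less[OF n]] ab by (intro image_subsetI) simp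
      ultimately show ?thesis
        unfolding \<phi>_def by (rule continuous_on_compose2[OF _ continuous_on_Lmap])
    qed
    \<comment> \<open>The left piece takes its value at \<open>t n\<close> from the argument
      \<open>b\<close>, the right piece from the argument \<open>a\<close>; by the join conditions
      both values are \<open>y n\<close>.\<close>
    moreover have "\<phi> n (t n) = \<phi> (Suc n) (t n)" if n: "n \<in> {1..<M}" for n
      using n less[of n] less[of "Suc n"] join0[of "Suc n"] join1[of n] g
      by (simp add: \<phi>_def S_iff a_def b_def)
    ultimately obtain h where h: "continuous_on {a..b} h"
      "\<And>n s. n \<in> {1..M} \<Longrightarrow> s \<in> {t (n - 1)..t n} \<Longrightarrow> h s = \<phi> n s"
      using continuous_glue_nodes[OF t M, of \<phi>] unfolding a_def b_def by blast
    obtain h' :: "real \<Rightarrow>\<^sub>C real" where h': "\<And>s. s \<in> cbox a b \<Longrightarrow> h' s = h s" "\<And>s. h' s = h (clamp a b s)"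
      using continuous_on_cbox_bcontfunE[of a b h] h(1) by (metis cbox_interval)
    have "h' (L n s) = \<alpha> n * g s + r n s" if "n \<in> {1..M}" "s \<in> {a..b}" for n s
    proof -
      have "L n s \<in> {t (n - 1)..t n}"
        unfolding L_def using Lmap_in[OF ab _ that(2)] less[OF that(1)] by simp
      moreover from this have "L n s \<in> cbox a b"
        using nodes_mono[OF t that(1)]
        by (auto simp: a_def b_def)
      moreover have "Lmap (t (n - 1)) (t n) a b (L n s) = s"
        unfolding L_def using Lmap_inverse less[OF that(1)] ab by simp
      ultimately show ?thesis using h(2) h'(1) that by (simp add: \<phi>_def)
    qed
    moreover have "h' s = h' (clamp a b s)" for s
      using h'(2)[of s] h'(2)[of "clamp a b s"] clamp_cancel_cbox[OF clamp_in_interval, of a b s] ab by simp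
    ultimately show ?thesis by blast
  qed
  then obtain T :: "(real \<Rightarrow>\<^sub>C real) \<Rightarrow> (real \<Rightarrow>\<^sub>C real)" where
    T: "\<And>g n s. g \<in> S \<Longrightarrow> n \<in> {1..M} \<Longrightarrow> s \<in> {a..b} \<Longrightarrow> T g (L n s) = \<alpha> n * g s + r n s" and
    T_clamp: "\<And>g s. g \<in> S \<Longrightarrow> T g s = T g (clamp a b s)"
    by metis
  define c where "c = Max ((\<lambda>n. \<bar>\<alpha> n\<bar>) ` {1..M})"
  have c: "c < 1" "\<And>n. n \<in> {1..M} \<Longrightarrow> \<bar>\<alpha> n\<bar> \<le> c"
    using \<alpha> M by (auto simp: c_def)
  have "0 \<le> c" using c(2)[of 1] M by auto
  have "\<exists>!g\<in>S. T g = g"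
  proof (rule Banach_fix)
    show "complete S"
      unfolding S_def by (auto simp: complete_eq_closed intro: closed_PiC)
    \<comment> \<open>The affine function with the two end values lies in \<open>S\<close>; here
      \<open>Lmap\<close> is used without any order between \<open>y 0\<close> and
      \<open>y M\<close>.\<close>
    obtain h :: "real \<Rightarrow>\<^sub>C real" where "\<And>s. s \<in> cbox a b \<Longrightarrow> h s = Lmap a b (y 0) (y M) s"
      using continuous_on_cbox_bcontfunE[OF continuous_on_Lmap] by blast
    then have "h \<in> S" using ab by (simp add: S_iff)
    then show "S \<noteq> {}" by blast
    \<comment> \<open>\<open>L 1\<close> fixes \<open>a\<close> and \<open>L M\<close> fixes
      \<open>b\<close>, so the first and the last join condition preserve the end values.\<close>
    show "T ` S \<subseteq> S"
      using T[of _ 1 a] T[of _ M b] M ab join0[of 1] join1[of M]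
      by (auto simp: L_def a_def b_def S_iff)
    fix g h assume gh: "g \<in> S" "h \<in> S"
    show "dist (T g) (T h) \<le> c * dist g h"
    proof (rule dist_bound)
      fix s
      have "clamp a b s \<in> {a..b}" using clamp_in_interval[of a b s] ab by simp
      then obtain n where n: "n \<in> {1..M}" "t (n - 1) \<le> clamp a b s" "clamp a b s \<le> t n"
        using nodes_cover[of t "clamp a b s" M] M unfolding a_def b_def by force
      \<comment> \<open>The clamped point is \<open>L n s'\<close>; at such a point
        \<open>r n s'\<close> cancels and the two images differ by
        \<open>\<alpha> n * (g s' - h s')\<close>.\<close>
      define s' where "s' = Lmap (t (n - 1)) (t n) a b (clamp a b s)"
      have s': "s' \<in> {a..b}" "clamp a b s = L n s'"
        unfolding s'_def L_def using Lmap_in[OF less[OF n(1)]] Lmap_inverse less[OF n(1)] ab n by auto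
      have "dist (T g s) (T h s) = \<bar>\<alpha> n\<bar> * dist (g s') (h s')"
        using T_clamp[OF gh(1), of s] T_clamp[OF gh(2), of s] T[OF gh(1) n(1) s'(1)] T[OF gh(2) n(1) s'(1)]
        by (simp add: s'(2) dist_real_def abs_mult flip: right_diff_distrib)
      also have "\<dots> \<le> c * dist g h"
        using c(2)[OF n(1)] dist_bounded[of g s' h] by (intro mult_mono) auto
      finally show "dist (T g s) (T h s) \<le> c * dist g h" .
    qed
  qed (use c \<open>0 \<le> c\<close> in auto)
  then obtain g where g: "g \<in> S" "T g = g" by blast
  show ?thesis
  proof (rule that[of g])
    show "g (t 0) = y 0" "g (t M) = y M" using g(1) by (auto simp: S_iff a_def b_def)
    show "g (Lmap (t 0) (t M) (t (n - 1)) (t n) s) = \<alpha> n * g s + r n s"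
      if "n \<in> {1..M}" "s \<in> {t 0..t M}" for n s
      using T[OF g(1) that(1), of s] that(2) g(2) by (simp add: L_def a_def b_def)
  qed auto
qed

section \<open>Uniqueness of the invariant compact set\<close>

text \<open>Used in both directions, this makes the attractor unique. A point of \<open>A\<close>
  can be traced back through \<open>n\<close> maps inside \<open>A\<close>; applying the same maps
  to a point of \<open>B\<close> gives a point of \<open>B\<close> at distance at most
  \<open>C ^ n * D\<close>. So \<open>A\<close> lies in the closure of \<open>B\<close>, which is
  \<open>B\<close>.\<close>

lemma hyperbolic_ifs_invariant_subset:
  assumes "hyperbolic_ifs X W" "invariant_compact X W A" "invariant_compact X W B"
  shows "A \<subseteq> B"
proof
  obtain d where d: "Metric_space X d" "Metric_space.mtopology X d = top_of_set X"
    and "\<forall>f\<in>W. \<exists>c. 0 \<le> c \<and> c < 1 \<and> (\<forall>u\<in>X. \<forall>v\<in>X. d (f u) (f v) \<le> c * d u v)"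
    using assms(1) by (auto simp: hyperbolic_ifs_def)
  then obtain c where c: "\<And>f. f \<in> W \<Longrightarrow> 0 \<le> c f" "\<And>f. f \<in> W \<Longrightarrow> c f < 1"
      "\<And>f u v. f \<in> W \<Longrightarrow> u \<in> X \<Longrightarrow> v \<in> X \<Longrightarrow> d (f u) (f v) \<le> c f * d u v"
    by metis
  have fin: "finite W"
    using assms(1) by (auto simp: hyperbolic_ifs_def)
  \<comment> \<open>Inserting 0 makes the set nonempty and the maximum nonnegative in every
    case.\<close>
  define C where "C = Max (insert 0 (c ` W))"
  have C: "0 \<le> C" "C < 1" "\<And>f. f \<in> W \<Longrightarrow> c f \<le> C"
    using fin c(2) by (auto simp: C_def)
  interpret Metric_space X d by fact
  have sub: "A \<subseteq> X" "B \<subseteq> X" and eq: "A = (\<Union>f\<in>W. f ` A)" "B = (\<Union>f\<in>W. f ` B)" and "B \<noteq> {}"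
    and cpt: "compact A" "compact B"
    using assms(2,3) unfolding invariant_compact_def by blast+
  \<comment> \<open>Compactness depends only on the topology, so \<open>A\<close> and
    \<open>B\<close> are compact for \<open>d\<close> too, hence bounded and closed for it.\<close>
  then have "mbounded (A \<union> B)" "closedin mtopology B"
    by (auto intro!: compactin_imp_mbounded compactin_imp_closedin
        simp: d(2) compactin_subtopology mbounded_Un Hausdorff_space_subtopology)
  then obtain D where D: "\<And>u v. u \<in> A \<Longrightarrow> v \<in> B \<Longrightarrow> d u v \<le> D"
    unfolding mbounded_alt by blast
  have approx: "\<forall>u\<in>A. \<exists>v\<in>B. d u v \<le> C ^ n * D" for n
  proof (induction n)
    case 0
    then show ?case using \<open>B \<noteq> {}\<close> D by fastforce
  next
    case (Suc n)
    show ?case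
    proof
      fix u assume "u \<in> A"
      then obtain f u' where f: "f \<in> W" "u' \<in> A" "u = f u'" using eq(1) by blast
      then obtain v' where v': "v' \<in> B" "d u' v' \<le> C ^ n * D" using Suc by blast
      have "d (f u') (f v') \<le> c f * d u' v'"
        using f v' sub c(3) by blast
      also have "\<dots> \<le> C * (C ^ n * D)"
        using C c(1) f v' by (intro mult_mono) auto
      finally have "d u (f v') \<le> C ^ Suc n * D" using f by (simp add: mult_ac)
      moreover have "f v' \<in> B" using eq(2) f v' by blast
      ultimately show "\<exists>v\<in>B. d u v \<le> C ^ Suc n * D" by blast
    qed
  qed
  fix u assume u: "u \<in> A"
  have "(\<lambda>n. C ^ n * D) \<longlonglongrightarrow> 0 * D"
    using C by (intro tendsto_intros LIMSEQ_realpow_zero) auto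
  then have lim: "\<exists>n. C ^ n * D < r" if "r > 0" for r
    using that order_tendstoD(2)[of _ 0 sequentially r]
    by (auto simp: eventually_sequentially)
  have "\<exists>v\<in>B. v \<in> mball u r" if r: "r > 0" for r
  proof -
    obtain n where "C ^ n * D < r" using lim[OF r] by blast
    moreover obtain v where "v \<in> B" "d u v \<le> C ^ n * D" using approx u by blast
    ultimately show ?thesis using u sub by (intro bexI[of _ v]) auto
  qed
  then have "u \<in> mtopology closure_of B"
    using u sub by (auto simp: metric_closure_of)
  then show "u \<in> B"
    using \<open>closedin mtopology B\<close> by (simp add: closure_of_closedin)
qed

section \<open>The sheared metric\<close>

text \<open>The shear \<open>\<Phi>\<close> is a homeomorphism of \<open>X\<close> onto itself with
  inverse \<open>\<Psi>\<close>, and \<open>d\<close> is the pullback of the sum metric along it.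
  The sum metric and the product metric bound each other up to a factor 3, so the topology carries
  over, and completeness follows because \<open>X\<close> is closed.\<close>

lemma Metric_space_shear:
  fixes K :: "real set" and g h :: "real \<Rightarrow> real"
  assumes "closed K" "continuous_on K g" "continuous_on K h"
  defines "X \<equiv> K \<times> (UNIV :: (real \<times> real) set)"
    and "d \<equiv> \<lambda>(s, a, b) (s', a', b').
      \<bar>s - s'\<bar> + \<bar>(a - g s) - (a' - g s')\<bar> + \<bar>(b - h s) - (b' - h s')\<bar>"
  shows "Metric_space X d" "Metric_space.mcomplete X d" "Metric_space.mtopology X d = top_of_set X"
proof -
  show M: "Metric_space X d"
    by unfold_locales (auto simp: d_def add_nonneg_eq_0_iff)
  interpret Metric_space X d by fact
  define \<Phi> where "\<Phi> = (\<lambda>(s, a, b). (s, a - g s, b - h s))"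
  define \<Psi> where "\<Psi> = (\<lambda>(s, a, b). (s, a + g s, b + h s))"
  have cont: "continuous_on X \<Phi>" "continuous_on X \<Psi>"
    unfolding \<Phi>_def \<Psi>_def X_def case_prod_unfold
    by (intro continuous_intros continuous_on_compose2[OF assms(2)] continuous_on_compose2[OF assms(3)]; auto)+
  have maps: "\<Phi> u \<in> X \<longleftrightarrow> u \<in> X" "\<Psi> u \<in> X \<longleftrightarrow> u \<in> X" "\<Phi> (\<Psi> u) = u" "\<Psi> (\<Phi> u) = u" for u
    by (auto simp: \<Phi>_def \<Psi>_def X_def split: prod.splits)
  have dist_le: "dist v w \<le> dist (fst v) (fst w) + dist (snd v) (snd w)"
    for v w :: "'a::metric_space \<times> 'b::metric_space"
    by (simp add: dist_prod_def sqrt_sum_squares_le_sum)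
  have le: "dist (\<Phi> u) (\<Phi> v) \<le> d u v" for u v
    using dist_le[of "\<Phi> u" "\<Phi> v"] dist_le[of "snd (\<Phi> u)" "snd (\<Phi> v)"]
    by (simp add: d_def \<Phi>_def dist_real_def split: prod.splits)
  \<comment> \<open>One summand for each of the three coordinates, each at most the product
    distance.\<close>
  have ge: "d u v \<le> 3 * dist (\<Phi> u) (\<Phi> v)" for u v
  proof -
    have "\<bar>fst (\<Phi> u) - fst (\<Phi> v)\<bar> \<le> dist (\<Phi> u) (\<Phi> v)"
      by (metis dist_fst_le dist_real_def)
    moreover have "\<bar>fst (snd (\<Phi> u)) - fst (snd (\<Phi> v))\<bar> \<le> dist (\<Phi> u) (\<Phi> v)"
      by (metis dist_fst_le dist_snd_le dist_real_def order_trans)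
    moreover have "\<bar>snd (snd (\<Phi> u)) - snd (snd (\<Phi> v))\<bar> \<le> dist (\<Phi> u) (\<Phi> v)"
      by (metis dist_snd_le dist_real_def order_trans)
    moreover have "d u v = \<bar>fst (\<Phi> u) - fst (\<Phi> v)\<bar> + \<bar>fst (snd (\<Phi> u)) - fst (snd (\<Phi> v))\<bar>
        + \<bar>snd (snd (\<Phi> u)) - snd (snd (\<Phi> v))\<bar>"
      by (simp add: d_def \<Phi>_def split: prod.splits)
    ultimately show ?thesis by linarith
  qed
  have fwd: "\<exists>\<delta>>0. \<forall>v\<in>X. dist v u < \<delta> \<longrightarrow> d u v < e" if u: "u \<in> X" and e: "e > 0" for u e
  proof -
    obtain \<delta> where \<delta>: "\<delta> > 0" "\<forall>v\<in>X. dist v u < \<delta> \<longrightarrow> dist (\<Phi> v) (\<Phi> u) < e / 3"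
      using cont(1)[unfolded continuous_on_iff, rule_format, of u "e / 3"] u e by auto
    have "d u v < e" if "v \<in> X" "dist v u < \<delta>" for v
      using \<delta>(2)[rule_format, OF that] ge[of u v] by (simp add: dist_commute)
    then show ?thesis using \<delta>(1) by blast
  qed
  have bwd: "\<exists>\<delta>>0. \<forall>v\<in>X. d u v < \<delta> \<longrightarrow> dist v u < e" if u: "u \<in> X" and e: "e > 0" for u e
  proof -
    obtain \<delta> where \<delta>: "\<delta> > 0" "\<forall>v\<in>X. dist v (\<Phi> u) < \<delta> \<longrightarrow> dist (\<Psi> v) (\<Psi> (\<Phi> u)) < e"
      using cont(2)[unfolded continuous_on_iff, rule_format, of "\<Phi> u" e] u e maps(1) by auto
    then have "dist v u < e" if "v \<in> X" "d u v < \<delta>" for v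
      using \<delta>(2)[rule_format, of "\<Phi> v"] that le[of u v] by (simp add: maps dist_commute)
    then show ?thesis using \<delta>(1) by blast
  qed
  show top: "mtopology = top_of_set X"
  proof (rule topology_eq[THEN iffD2], intro allI iffI)
    fix U assume U: "openin mtopology U"
    have "\<exists>e>0. \<forall>v\<in>X. dist v u < e \<longrightarrow> v \<in> U" if "u \<in> U" for u
    proof -
      obtain r where "r > 0" "mball u r \<subseteq> U" "u \<in> X"
        using U \<open>u \<in> U\<close> unfolding openin_mtopology by blast
      then show ?thesis using fwd[of u r] by (metis in_mball subsetD)
    qed
    then show "openin (top_of_set X) U"
      using U unfolding openin_euclidean_subtopology_iff openin_mtopology by blast
  next
    fix U assume U: "openin (top_of_set X) U"
    have "\<exists>r>0. mball u r \<subseteq> U" if "u \<in> U" for u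
    proof -
      obtain e where "e > 0" "\<forall>v\<in>X. dist v u < e \<longrightarrow> v \<in> U" "u \<in> X"
        using U \<open>u \<in> U\<close> unfolding openin_euclidean_subtopology_iff by blast
      then show ?thesis using bwd[of u e] by (metis in_mball subsetI)
    qed
    then show "openin mtopology U"
      using U unfolding openin_euclidean_subtopology_iff openin_mtopology by blast
  qed
  show "mcomplete"
    unfolding mcomplete_def
  proof (intro allI impI)
    fix \<sigma> assume \<sigma>: "MCauchy \<sigma>"
    \<comment> \<open>The sheared sequence is Cauchy in the Euclidean sense; its limit in
      \<open>X\<close> is carried back by the continuous \<open>\<Psi>\<close>.\<close>
    then have "Cauchy (\<Phi> \<circ> \<sigma>)"
      unfolding MCauchy_def Cauchy_def o_def by (meson le le_less_trans)
    moreover have "complete X"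
      using assms(1) by (auto simp: complete_eq_closed X_def intro: closed_Times)
    moreover have "\<forall>n. (\<Phi> \<circ> \<sigma>) n \<in> X"
      using \<sigma> by (auto simp: MCauchy_def maps)
    ultimately obtain l where l: "l \<in> X" "(\<Phi> \<circ> \<sigma>) \<longlonglongrightarrow> l"
      unfolding complete_def by blast
    have "(\<lambda>n. \<Psi> ((\<Phi> \<circ> \<sigma>) n)) \<longlonglongrightarrow> \<Psi> l"
      using cont(2) l \<open>\<forall>n. (\<Phi> \<circ> \<sigma>) n \<in> X\<close>
      by (intro continuous_on_tendsto_compose[of X \<Psi>]) (auto simp: o_def)
    then have "\<sigma> \<longlonglongrightarrow> \<Psi> l" by (simp add: maps)
    then have "limitin mtopology \<sigma> (\<Psi> l) sequentially"
      using \<sigma> l unfolding top limitin_subtopology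
      by (auto simp: MCauchy_def maps image_subset_iff intro!: eventuallyI)
    then show "\<exists>l. limitin mtopology \<sigma> l sequentially" ..
  qed
qed

section \<open>Hyperbolicity and attractor for a partition into at least two subintervals\<close>

lemma fractal_system_attractor:
  fixes t y z \<alpha> \<beta> \<gamma> :: "nat \<Rightarrow> real" and p q :: "nat \<Rightarrow> real \<Rightarrow> real"
  assumes t: "strict_mono_on {0..M} t" and M: "M \<ge> 2"
    and coeff: "\<And>n. n \<in> {1..M} \<Longrightarrow> \<bar>\<alpha> n\<bar> < 1 \<and> \<bar>\<gamma> n\<bar> < 1 \<and> \<bar>\<beta> n\<bar> + \<bar>\<gamma> n\<bar> < 1"
    and cont: "\<And>n. n \<in> {1..M} \<Longrightarrow> continuous_on {t 0..t M} (p n) \<and> continuous_on {t 0..t M} (q n)"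
    and join0: "\<And>n. n \<in> {1..M} \<Longrightarrow>
      Fmap (\<alpha> n) (\<beta> n) (\<gamma> n) (p n) (q n) (t 0, y 0, z 0) = (y (n - 1), z (n - 1))"
    and join1: "\<And>n. n \<in> {1..M} \<Longrightarrow>
      Fmap (\<alpha> n) (\<beta> n) (\<gamma> n) (p n) (q n) (t M, y M, z M) = (y n, z n)"
  defines "X \<equiv> {t 0..t M} \<times> (UNIV :: (real \<times> real) set)"
    and "\<omega> \<equiv> \<lambda>n. pair_map (Lmap (t 0) (t M) (t (n - 1)) (t n)) (Fmap (\<alpha> n) (\<beta> n) (\<gamma> n) (p n) (q n))"
  shows "hyperbolic_ifs X (\<omega> ` {1..M})" and "\<exists>A. is_attractor X (\<omega> ` {1..M}) A"
proof -
  define a b where "a = t 0" and "b = t M"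
  define L where "L n = Lmap a b (t (n - 1)) (t n)" for n
  have \<omega>: "\<omega> n (s, u, v) = (L n s, \<alpha> n * u + \<beta> n * v + p n s, \<gamma> n * v + q n s)" for n s u v
    by (simp add: \<omega>_def pair_map_def Fmap_def L_def a_def b_def)
  have X: "X = {a..b} \<times> UNIV" by (simp add: X_def a_def b_def)
  have ab: "a < b"
    using strict_mono_onD[OF t, of 0 M] M by (auto simp: a_def b_def)
  have less: "t (n - 1) < t n" if "n \<in> {1..M}" for n
    using nodes_mono(2)[OF t that] .
  have nodes: "a \<le> t (n - 1)" "t n \<le> b" if "n \<in> {1..M}" for n
    using nodes_mono[OF t that] by (auto simp: a_def b_def)
  have L_in: "L n s \<in> {a..b}" if "n \<in> {1..M}" "s \<in> {a..b}" for n s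
    using Lmap_in[OF ab _ that(2), of "t (n - 1)" "t n"] less[OF that(1)] nodes[OF that(1)]
    by (auto simp: L_def)
  have L_onto: "\<exists>n\<in>{1..M}. \<exists>s'\<in>{a..b}. s = L n s'" if s: "s \<in> {a..b}" for s
  proof -
    obtain n where n: "n \<in> {1..M}" "t (n - 1) \<le> s" "s \<le> t n"
      using nodes_cover[of t s M] M s unfolding a_def b_def by force
    then show ?thesis
      using Lmap_in[OF less[OF n(1)], of a b s] Lmap_inverse[of a b "t (n - 1)" "t n" s] less[OF n(1)] ab
      by (intro bexI[of _ n] bexI[of _ "Lmap (t (n - 1)) (t n) a b s"]) (auto simp: L_def)
  qed
  \<comment> \<open>With at least two subintervals none of them is all of \<open>[a, b]\<close>, so
    the base maps contract strictly.\<close>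
  have L_ratio: "(t n - t (n - 1)) / (b - a) < 1" if n: "n \<in> {1..M}" for n
  proof -
    have "t 0 < t (n - 1) \<or> t n < t M"
      using strict_mono_onD[OF t, of 0 "n - 1"] strict_mono_onD[OF t, of n M] n M
      by (cases "n = 1") auto
    then show ?thesis using nodes[OF n] ab by (auto simp: a_def b_def)
  qed

  \<comment> \<open>\<open>h\<close> comes first because the last component of the maps does not
    involve the middle coordinate.\<close>
  obtain h where h: "continuous_on {a..b} h" "h a = z 0" "h b = z M"
    "\<And>n s. n \<in> {1..M} \<Longrightarrow> s \<in> {a..b} \<Longrightarrow> h (L n s) = \<gamma> n * h s + q n s"
    unfolding L_def a_def b_def
    by (rule fractal_interpolant[of M t \<gamma> q z]) (use t M coeff cont join0 join1 in \<open>auto simp: Fmap_def\<close>)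
  \<comment> \<open>Now that \<open>h\<close> is fixed, \<open>\<beta> n * h s + p n s\<close> is a
    function of \<open>s\<close> alone and serves as the inhomogeneous term; the end values of
    \<open>h\<close> turn the join-up conditions into those for \<open>g\<close>.\<close>
  obtain g where g: "continuous_on {a..b} g" "g a = y 0" "g b = y M"
    "\<And>n s. n \<in> {1..M} \<Longrightarrow> s \<in> {a..b} \<Longrightarrow> g (L n s) = \<alpha> n * g s + (\<beta> n * h s + p n s)"
    unfolding L_def a_def b_def
  proof (rule fractal_interpolant[of M t \<alpha> "\<lambda>n s. \<beta> n * h s + p n s" y])
    show "continuous_on {t 0..t M} (\<lambda>s. \<beta> n * h s + p n s)" if "n \<in> {1..M}" for n
      using h(1) cont[OF that] by (intro continuous_intros) (auto simp: a_def b_def)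
    show "\<alpha> n * y 0 + (\<beta> n * h (t 0) + p n (t 0)) = y (n - 1)"
      "\<alpha> n * y M + (\<beta> n * h (t M) + p n (t M)) = y n" if "n \<in> {1..M}" for n
      using join0[OF that] join1[OF that] h(2,3) by (auto simp: Fmap_def a_def b_def add.assoc)
  qed (use t M coeff in auto)

  define d where "d = (\<lambda>(s, u, v) (s', u', v').
      \<bar>s - s'\<bar> + \<bar>(u - g s) - (u' - g s')\<bar> + \<bar>(v - h s) - (v' - h s')\<bar>)"
  have contraction: "\<exists>c. 0 \<le> c \<and> c < 1 \<and> (\<forall>u\<in>X. \<forall>v\<in>X. d (\<omega> n u) (\<omega> n v) \<le> c * d u v)"
    if n: "n \<in> {1..M}" for n
  proof -
    define \<rho> where "\<rho> = (t n - t (n - 1)) / (b - a)"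
    \<comment> \<open>The ratio of the base map together with the two column sums of the matrix with
      rows \<open>(\<alpha> n, \<beta> n)\<close> and \<open>(0, \<gamma> n)\<close>.\<close>
    define c where "c = max \<rho> (max \<bar>\<alpha> n\<bar> (\<bar>\<beta> n\<bar> + \<bar>\<gamma> n\<bar>))"
    have c: "0 \<le> \<rho>" "\<rho> \<le> c" "\<bar>\<alpha> n\<bar> \<le> c" "\<bar>\<beta> n\<bar> + \<bar>\<gamma> n\<bar> \<le> c" "c < 1" "0 \<le> c"
    proof -
      have \<rho>: "0 \<le> \<rho>" "\<rho> < 1" using L_ratio[OF n] less[OF n] ab by (auto simp: \<rho>_def)
      then show "0 \<le> \<rho>" "\<rho> \<le> c" "\<bar>\<alpha> n\<bar> \<le> c" "\<bar>\<beta> n\<bar> + \<bar>\<gamma> n\<bar> \<le> c" "c < 1" "0 \<le> c"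
        using coeff[OF n] by (auto simp: c_def le_max_iff_disj)
    qed
    have "d (\<omega> n (s, u, v)) (\<omega> n (s', u', v')) \<le> c * d (s, u, v) (s', u', v')"
      if s: "s \<in> {a..b}" "s' \<in> {a..b}" for s u v s' u' v'
    proof -
      define U V where "U = (u - g s) - (u' - g s')" and "V = (v - h s) - (v' - h s')"
      \<comment> \<open>The functional equations of \<open>g\<close> and \<open>h\<close> absorb
        \<open>p n\<close> and \<open>q n\<close>: the offset from the graph is transformed
        linearly.\<close>
      have "d (\<omega> n (s, u, v)) (\<omega> n (s', u', v')) = \<bar>L n s - L n s'\<bar> + \<bar>\<alpha> n * U + \<beta> n * V\<bar> + \<bar>\<gamma> n * V\<bar>"
        using g(4)[OF n s(1)] g(4)[OF n s(2)] h(4)[OF n s(1)] h(4)[OF n s(2)]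
        by (simp add: d_def \<omega> U_def V_def algebra_simps)
      also have "L n s - L n s' = \<rho> * (s - s')"
        by (simp add: L_def Lmap_diff \<rho>_def)
      also have "\<bar>\<rho> * (s - s')\<bar> + \<bar>\<alpha> n * U + \<beta> n * V\<bar> + \<bar>\<gamma> n * V\<bar>
          \<le> \<rho> * \<bar>s - s'\<bar> + \<bar>\<alpha> n\<bar> * \<bar>U\<bar> + (\<bar>\<beta> n\<bar> + \<bar>\<gamma> n\<bar>) * \<bar>V\<bar>"
        using c(1) abs_triangle_ineq[of "\<alpha> n * U" "\<beta> n * V"] by (simp add: abs_mult distrib_right)
      also have "\<dots> \<le> c * \<bar>s - s'\<bar> + c * \<bar>U\<bar> + c * \<bar>V\<bar>"
        using c by (intro add_mono mult_right_mono) auto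
      also have "\<dots> = c * d (s, u, v) (s', u', v')"
        by (simp add: d_def U_def V_def distrib_left)
      finally show ?thesis .
    qed
    then have "\<forall>u\<in>X. \<forall>v\<in>X. d (\<omega> n u) (\<omega> n v) \<le> c * d u v"
      unfolding X by auto
    then show ?thesis using c(5,6) by blast
  qed
  have "\<omega> n ` X \<subseteq> X" if "n \<in> {1..M}" for n
    using L_in[OF that] by (auto simp: X \<omega>)
  moreover have "Metric_space X d" "Metric_space.mcomplete X d" "Metric_space.mtopology X d = top_of_set X"
    using Metric_space_shear[OF closed_atLeastAtMost g(1) h(1)] unfolding X d_def by blast+
  ultimately show hyp: "hyperbolic_ifs X (\<omega> ` {1..M})"
    using contraction unfolding hyperbolic_ifs_def by blast

  define A where "A = (\<lambda>s. (s, g s, h s)) ` {a..b}"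
  have graph: "\<omega> n (s, g s, h s) = (L n s, g (L n s), h (L n s))" if "n \<in> {1..M}" "s \<in> {a..b}" for n s
    using g(4)[OF that] h(4)[OF that] by (simp add: \<omega> add.assoc)
  \<comment> \<open>Each map carries the graph onto its part over one subinterval, and the
    subintervals cover \<open>[a, b]\<close>.\<close>
  have "A = (\<Union>f\<in>\<omega> ` {1..M}. f ` A)"
  proof (intro equalityI subsetI)
    fix u assume "u \<in> A"
    then obtain s where s: "s \<in> {a..b}" "u = (s, g s, h s)" by (auto simp: A_def)
    then obtain n s' where n: "n \<in> {1..M}" "s' \<in> {a..b}" "s = L n s'" using L_onto by blast
    then have "u = \<omega> n (s', g s', h s')" using graph s by simp
    moreover have "(s', g s', h s') \<in> A" using n(2) by (simp add: A_def)
    ultimately show "u \<in> (\<Union>f\<in>\<omega> ` {1..M}. f ` A)" using n(1) by blast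
  next
    fix u assume "u \<in> (\<Union>f\<in>\<omega> ` {1..M}. f ` A)"
    then obtain n s where n: "n \<in> {1..M}" "s \<in> {a..b}" "u = \<omega> n (s, g s, h s)"
      unfolding A_def by blast
    then show "u \<in> A" using graph[OF n(1,2)] L_in[OF n(1,2)] by (auto simp: A_def)
  qed
  moreover have "compact A"
    unfolding A_def by (intro compact_continuous_image continuous_intros g h) auto
  moreover have "A \<subseteq> X" "A \<noteq> {}"
    using ab by (auto simp: A_def X)
  ultimately have "invariant_compact X (\<omega> ` {1..M}) A"
    unfolding invariant_compact_def by blast
  then have "is_attractor X (\<omega> ` {1..M}) A"
    unfolding is_attractor_def using hyperbolic_ifs_invariant_subset[OF hyp] by blast
  then show "\<exists>A. is_attractor X (\<omega> ` {1..M}) A" ..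
qed

section \<open>Reindexing for the inserted node\<close>

definition insert_at :: "nat \<Rightarrow> 'a \<Rightarrow> (nat \<Rightarrow> 'a) \<Rightarrow> nat \<Rightarrow> 'a" where
  "insert_at k v f i = (if i < k then f i else if i = k then v else f (i - 1))"

lemma insert_at_simps [simp]:
  "i < k \<Longrightarrow> insert_at k v f i = f i"
  "insert_at k v f k = v"
  "k \<le> i \<Longrightarrow> insert_at k v f (Suc i) = f i"
  by (auto simp: insert_at_def)

lemma strict_mono_insert_at:
  fixes x :: "nat \<Rightarrow> real"
  assumes x: "strict_mono_on {0..N} x" and k: "k \<in> {1..N}" and v: "x (k - 1) < v" "v < x k"
  shows "strict_mono_on {0..Suc N} (insert_at k v x)"
proof (rule strict_mono_onI)
  fix i j assume ij: "i \<in> {0..Suc N}" "j \<in> {0..Suc N}" "i < j"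
  have low: "x i < v" if "i < k"
  proof -
    have "i \<le> k - 1" "k - 1 \<le> N" using that k by auto
    then show ?thesis using strict_mono_on_leD[OF x, of i "k - 1"] v by auto
  qed
  have high: "v < x (j - 1)" if "k < j"
  proof -
    have "k \<le> j - 1" "j - 1 \<le> N" using that ij by auto
    then show ?thesis using strict_mono_on_leD[OF x, of k "j - 1"] v by auto
  qed
  have mono: "x i' < x j'" if "i' < j'" "j' \<le> N" for i' j'
    using strict_mono_onD[OF x, of i' j'] that by auto
  consider "j < k" | "j = k" | "i < k" "k < j" | "i = k" | "k < i" using ij(3) by linarith
  then show "insert_at k v x i < insert_at k v x j"
  proof cases
    case 1
    then show ?thesis using ij k mono[of i j] by simp
  next
    case 3
    then show ?thesis using low high by (auto simp: insert_at_def)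
  next
    case 5
    then show ?thesis using ij k mono[of "i - 1" "j - 1"] by (auto simp: insert_at_def)
  qed (use ij low high in \<open>auto simp: insert_at_def\<close>)
qed

theorem theorem3p1:
  fixes N k :: nat
    and x y z \<alpha> \<beta> \<gamma> :: "nat \<Rightarrow> real"
    and p q :: "nat \<Rightarrow> real \<Rightarrow> real"
    and xh yh zh \<alpha>l \<beta>l \<gamma>l \<alpha>r \<beta>r \<gamma>r :: real
    and pl ql pr qr :: "real \<Rightarrow> real"
  assumes "N \<ge> 2"
    and "strict_mono_on {0..N} x"
    and "\<And>n. n \<in> {1..N} \<Longrightarrow> \<bar>\<alpha> n\<bar> < 1 \<and> \<bar>\<gamma> n\<bar> < 1 \<and> \<bar>\<beta> n\<bar> + \<bar>\<gamma> n\<bar> < 1"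
    and "\<And>n. n \<in> {1..N} \<Longrightarrow> continuous_on {x 0..x N} (p n) \<and> continuous_on {x 0..x N} (q n)"
    and "\<And>n. n \<in> {1..N} \<Longrightarrow>
           Fmap (\<alpha> n) (\<beta> n) (\<gamma> n) (p n) (q n) (x 0, y 0, z 0) = (y (n - 1), z (n - 1)) \<and>
           Fmap (\<alpha> n) (\<beta> n) (\<gamma> n) (p n) (q n) (x N, y N, z N) = (y n, z n)"
    and "k \<in> {1..N}" and "x (k - 1) < xh" and "xh < x k"
    and "\<bar>\<alpha>l\<bar> < 1" and "\<bar>\<gamma>l\<bar> < 1" and "\<bar>\<beta>l\<bar> + \<bar>\<gamma>l\<bar> < 1"
    and "continuous_on {x 0..x N} pl" and "continuous_on {x 0..x N} ql"
    and "Fmap \<alpha>l \<beta>l \<gamma>l pl ql (x 0, y 0, z 0) = (y (k - 1), z (k - 1))"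
    and "Fmap \<alpha>l \<beta>l \<gamma>l pl ql (x N, y N, z N) = (yh, zh)"
    and "\<bar>\<alpha>r\<bar> < 1" and "\<bar>\<gamma>r\<bar> < 1" and "\<bar>\<beta>r\<bar> + \<bar>\<gamma>r\<bar> < 1"
    and "continuous_on {x 0..x N} pr" and "continuous_on {x 0..x N} qr"
    and "Fmap \<alpha>r \<beta>r \<gamma>r pr qr (x 0, y 0, z 0) = (yh, zh)"
    and "Fmap \<alpha>r \<beta>r \<gamma>r pr qr (x N, y N, z N) = (y k, z k)"
  shows
    "let X = {x 0..x N} \<times> (UNIV :: (real \<times> real) set);
         \<omega> = (\<lambda>n. pair_map (Lmap (x 0) (x N) (x (n - 1)) (x n))
                           (Fmap (\<alpha> n) (\<beta> n) (\<gamma> n) (p n) (q n)));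
         \<omega>l = pair_map (Lmap (x 0) (x N) (x (k - 1)) xh) (Fmap \<alpha>l \<beta>l \<gamma>l pl ql);
         \<omega>r = pair_map (Lmap (x 0) (x N) xh (x k)) (Fmap \<alpha>r \<beta>r \<gamma>r pr qr);
         W = \<omega> ` ({1..N} - {k}) \<union> {\<omega>l, \<omega>r}
     in hyperbolic_ifs X W \<and>
        (\<exists>A. is_attractor X W A \<and>
             A = (\<Union>n\<in>{1..N} - {k}. \<omega> n ` A) \<union> \<omega>l ` A \<union> \<omega>r ` A)"
proof -
  define X where "X = {x 0..x N} \<times> (UNIV :: (real \<times> real) set)"
  define \<omega> where "\<omega> n = pair_map (Lmap (x 0) (x N) (x (n - 1)) (x n))
    (Fmap (\<alpha> n) (\<beta> n) (\<gamma> n) (p n) (q n))" for n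
  define \<omega>l where "\<omega>l = pair_map (Lmap (x 0) (x N) (x (k - 1)) xh) (Fmap \<alpha>l \<beta>l \<gamma>l pl ql)"
  define \<omega>r where "\<omega>r = pair_map (Lmap (x 0) (x N) xh (x k)) (Fmap \<alpha>r \<beta>r \<gamma>r pr qr)"
  define W where "W = \<omega> ` ({1..N} - {k}) \<union> {\<omega>l, \<omega>r}"

  define t y' z' where "t = insert_at k xh x" and "y' = insert_at k yh y" and "z' = insert_at k zh z"
  \<comment> \<open>Splitting interval \<open>k\<close> replaces its map by two. Overwriting entry
    \<open>k\<close> by the right-hand data before inserting the left-hand data at \<open>k\<close>
    leaves the left map at index \<open>k\<close> and the right one at \<open>Suc k\<close>.\<close>
  define a b c P Q where "a = insert_at k \<alpha>l (\<alpha>(k := \<alpha>r))" and "b = insert_at k \<beta>l (\<beta>(k := \<beta>r))"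
    and "c = insert_at k \<gamma>l (\<gamma>(k := \<gamma>r))" and "P = insert_at k pl (p(k := pr))"
    and "Q = insert_at k ql (q(k := qr))"
  note new_defs = t_def y'_def z'_def a_def b_def c_def P_def Q_def
  define \<omega>' where "\<omega>' n = pair_map (Lmap (t 0) (t (Suc N)) (t (n - 1)) (t n))
    (Fmap (a n) (b n) (c n) (P n) (Q n))" for n
  have k: "0 < k" "k - 1 < k" "k \<le> N" using \<open>k \<in> {1..N}\<close> by auto
  \<comment> \<open>As \<open>k\<close> lies in \<open>{1..N}\<close>, the insertion changes neither
    end point, so both systems share the space and the join-up arguments.\<close>
  have ends: "t 0 = x 0" "t (Suc N) = x N" "y' 0 = y 0" "y' (Suc N) = y N" "z' 0 = z 0" "z' (Suc N) = z N"
    using k by (auto simp: new_defs)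
  \<comment> \<open>Beyond \<open>Suc k\<close> the double successor lets \<open>insert_at\<close>
    be evaluated at \<open>n\<close> and at \<open>n - 1\<close> alike, both past the inserted
    entry.\<close>
  have cases: thesis
    if n: "n \<in> {1..Suc N}" and "n < k \<Longrightarrow> thesis" "n = k \<Longrightarrow> thesis" "n = Suc k \<Longrightarrow> thesis"
      "\<And>m. n = Suc (Suc m) \<Longrightarrow> k \<le> m \<Longrightarrow> Suc m \<le> N \<Longrightarrow> thesis" for n thesis
  proof -
    have "n = Suc (Suc (n - 2))" "k \<le> n - 2" "Suc (n - 2) \<le> N" if "Suc k < n"
      using that n by auto
    then show ?thesis using that by (metis linorder_neqE_nat not_less_eq)
  qed
  have pieces: "(\<bar>a n\<bar> < 1 \<and> \<bar>c n\<bar> < 1 \<and> \<bar>b n\<bar> + \<bar>c n\<bar> < 1) \<and>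
      (continuous_on {x 0..x N} (P n) \<and> continuous_on {x 0..x N} (Q n)) \<and>
      Fmap (a n) (b n) (c n) (P n) (Q n) (x 0, y 0, z 0) = (y' (n - 1), z' (n - 1)) \<and>
      Fmap (a n) (b n) (c n) (P n) (Q n) (x N, y N, z N) = (y' n, z' n)"
    if n: "n \<in> {1..Suc N}" for n
  proof (rule cases[OF n])
    assume "n < k"
    then show ?thesis using assms(3-5)[of n] n k by (simp add: new_defs)
  next
    assume "n = k"
    then show ?thesis using assms(9-15) k by (simp add: new_defs)
  next
    assume "n = Suc k"
    then show ?thesis using assms(16-) k by (simp add: new_defs)
  next
    fix m assume "n = Suc (Suc m)" "k \<le> m" "Suc m \<le> N"
    then show ?thesis using assms(3-5)[of "Suc m"] by (simp add: new_defs)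
  qed
  have \<omega>': "\<omega>' n = (if n < k then \<omega> n else if n = k then \<omega>l else if n = Suc k then \<omega>r else \<omega> (n - 1))"
    if n: "n \<in> {1..Suc N}" for n
  proof (rule cases[OF n])
    assume "n < k"
    then show ?thesis by (simp add: \<omega>'_def \<omega>_def ends) (simp add: new_defs)
  next
    assume "n = k"
    then show ?thesis using k by (simp add: \<omega>'_def \<omega>l_def ends) (simp add: new_defs)
  next
    assume "n = Suc k"
    then show ?thesis by (simp add: \<omega>'_def \<omega>r_def ends) (simp add: new_defs)
  next
    fix m assume "n = Suc (Suc m)" "k \<le> m" "Suc m \<le> N"
    then show ?thesis by (simp add: \<omega>'_def \<omega>_def ends) (simp add: new_defs)
  qed
  have "\<omega>' ` {1..Suc N} = W"
  proof (intro equalityI subsetI)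
    fix f assume "f \<in> \<omega>' ` {1..Suc N}"
    then obtain n where n: "n \<in> {1..Suc N}" "f = \<omega>' n" by blast
    have "n < k \<Longrightarrow> n \<in> {1..N} - {k}" "Suc k < n \<Longrightarrow> n - 1 \<in> {1..N} - {k}" using n k by auto
    then show "f \<in> W"
      using \<omega>'[OF n(1)] n(2) unfolding W_def
      by (cases n "Suc k" rule: linorder_cases) (auto split: if_splits)
  next
    fix f assume "f \<in> W"
    then consider n where "n \<in> {1..N}" "n \<noteq> k" "f = \<omega> n" | "f = \<omega>l" | "f = \<omega>r"
      unfolding W_def by blast
    then show "f \<in> \<omega>' ` {1..Suc N}"
    proof cases
      case 1
      \<comment> \<open>An old map keeps its index before \<open>k\<close> and moves up by one after
        it.\<close>
      then have "f = \<omega>' (if n < k then n else Suc n)" using \<omega>'[of n] \<omega>'[of "Suc n"] by auto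
      then show ?thesis using 1 by auto
    next
      case 2
      then show ?thesis using \<omega>'[of k] k by (intro image_eqI[of _ _ k]) auto
    next
      case 3
      then show ?thesis using \<omega>'[of "Suc k"] k by (intro image_eqI[of _ _ "Suc k"]) auto
    qed
  qed
  moreover have "hyperbolic_ifs X (\<omega>' ` {1..Suc N})" "\<exists>A. is_attractor X (\<omega>' ` {1..Suc N}) A"
    using fractal_system_attractor[of "Suc N" t a c b P Q y' z'] pieces assms(1)
      strict_mono_insert_at[OF assms(2,6-8)]
    unfolding \<omega>'_def X_def ends t_def[symmetric] by simp_all
  ultimately obtain A where hyp: "hyperbolic_ifs X W" and A: "is_attractor X W A" by auto
  have "A = (\<Union>f\<in>W. f ` A)"
    using A by (simp add: is_attractor_def invariant_compact_def)
  also have "\<dots> = (\<Union>n\<in>{1..N} - {k}. \<omega> n ` A) \<union> \<omega>l ` A \<union> \<omega>r ` A"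
    unfolding W_def by blast
  finally have "hyperbolic_ifs X W \<and>
      (\<exists>A. is_attractor X W A \<and> A = (\<Union>n\<in>{1..N} - {k}. \<omega> n ` A) \<union> \<omega>l ` A \<union> \<omega>r ` A)"
    using hyp A by blast
  then show ?thesis
    unfolding Let_def W_def X_def \<omega>_def \<omega>l_def \<omega>r_def .
qed

end
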